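(* Let $p\in(0,1)$, $\lambda>0$, let $\mu_1,\mu_{-1}\in\mathbb{R}^d$ be such that there is no $c\in\mathbb{R}$ with $\mu_1=c\,\mu_{-1}$ or $\mu_{-1}=c\,\mu_1$, and let $\Sigma_1,\Sigma_{-1}\in\mathbb{R}^{d\times d}$ be symmetric positive definite. Let $\alpha:[0,\infty)\to[0,1]^2$ be a solution of the reduced walk-up rate dynamics with initial condition $\alpha(0)\in[0,1]^2\setminus\{(0,0)\}$. Then $\alpha(t)$ does not converge to $(0,0)$ as $t\to\infty$.
   Context: There are two user classes $1$ (popular) and $-1$ (niche); $p\in(0,1)$ is the fraction of class-$1$ users. User features are Gaussian: $X\mid y=i\sim\mathcal N(\mu_i,\Sigma_i)$ for $i\in\{1,-1\}$. The state is the pair of walk-up rates $\alpha=(\alpha_1,\alpha_{-1})\in[0,1]^2$. For $\alpha\in[0,1]^2$ set $$A_\alpha=p\alpha_1(\Sigma_1+\mu_1\mu_1^\top)+(1-p)\alpha_{-1}(\Sigma_{-1}+\mu_{-1}\mu_{-1}^\top)+\lambda I,\quad b_\alpha=p\alpha_1\mu_1-(1-p)\alpha_{-1}\mu_{-1},\quad F(\alpha)=A_\alpha^{-1}b_\alpha .$$ ($F(\alpha)$ is the minimiser of the expected regularised squared loss of the linear classifier when the walk-up rates are $\alpha$.) For $\theta\in\mathbb{R}^d$ let $\hat p_1(\theta)=\mathbb P_{X\sim\mathcal N(\mu_1,\Sigma_1)}[\theta^\top X\ge 0]$ and $\hat p_{-1}(\theta)=\mathbb P_{X\sim\mathcal N(\mu_{-1},\Sigma_{-1})}[\theta^\top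 X<0]$. The reduced walk-up rate dynamics (obtained by two-time-scale separation, with the classifier parameter $\theta$ fast and $\alpha$ slow) are $$\dot\alpha_1=\Gamma\{p\,\alpha_1(2\hat p_1(\theta)-1)\},\qquad \dot\alpha_{-1}=\Gamma\{(1-p)\,\alpha_{-1}(2\hat p_{-1}(\theta)-1)\},\qquad \theta=F(\alpha),$$ where $\Gamma$ denotes projection of the dynamics keeping each $\alpha_i$ in $[0,1]$: the velocity component is unchanged when $0<\alpha_i<1$, is replaced by its positive part when $\alpha_i=0$, and by $\min(\cdot,0)$ of it when $\alpha_i=1$. A solution is an absolutely continuous function satisfying these equations for almost every $t\ge0$. *)

theory Defs
  imports "HOL-Probability.Probability"
begin

text \<open>
  The subscripts \<open>P\<close> and \<open>N\<close> stand for the popular class \<open>1\<close> and the niche class \<open>-1\<close>.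
  A state is the pair \<open>(\<alpha>\<^sub>1, \<alpha>\<^sub>-\<^sub>1)\<close> of walk-up rates, popular class first.
\<close>

definition sym_pos_def :: "real^'n^'n \<Rightarrow> bool" where
  "sym_pos_def S \<longleftrightarrow> transpose S = S \<and> (\<forall>x. x \<noteq> 0 \<longrightarrow> x \<bullet> (S *v x) > 0)"

definition outer :: "real^'n \<Rightarrow> real^'n \<Rightarrow> real^'n^'n" where
  "outer u v = (\<chi> i j. u $ i * v $ j)"

definition gaussian_density :: "real^'n \<Rightarrow> real^'n^'n \<Rightarrow> real^'n \<Rightarrow> real" where
  "gaussian_density m S x =
     exp (- ((x - m) \<bullet> (matrix_inv S *v (x - m))) / 2) / sqrt ((2 * pi) ^ CARD('n) * det S)"

text \<open>The nondegenerate Gaussian law; only meaningful when \<open>sym_pos_def S\<close> holds.\<close>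

definition gaussian :: "real^'n \<Rightarrow> real^'n^'n \<Rightarrow> (real^'n) measure" where
  "gaussian m S = density lborel (\<lambda>x. ennreal (gaussian_density m S x))"

definition A_mat ::
  "real \<Rightarrow> real \<Rightarrow> real^'n \<Rightarrow> real^'n \<Rightarrow> real^'n^'n \<Rightarrow> real^'n^'n \<Rightarrow> real \<times> real \<Rightarrow> real^'n^'n" where
  "A_mat p reg \<mu>\<^sub>P \<mu>\<^sub>N S\<^sub>P S\<^sub>N a =
     (p * fst a) *\<^sub>R (S\<^sub>P + outer \<mu>\<^sub>P \<mu>\<^sub>P)
     + ((1 - p) * snd a) *\<^sub>R (S\<^sub>N + outer \<mu>\<^sub>N \<mu>\<^sub>N) + reg *\<^sub>R mat 1"

definition b_vec :: "real \<Rightarrow> real^'n \<Rightarrow> real^'n \<Rightarrow> real \<times> real \<Rightarrow> real^'n" where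
  "b_vec p \<mu>\<^sub>P \<mu>\<^sub>N a = (p * fst a) *\<^sub>R \<mu>\<^sub>P - ((1 - p) * snd a) *\<^sub>R \<mu>\<^sub>N"

definition F_classifier ::
  "real \<Rightarrow> real \<Rightarrow> real^'n \<Rightarrow> real^'n \<Rightarrow> real^'n^'n \<Rightarrow> real^'n^'n \<Rightarrow> real \<times> real \<Rightarrow> real^'n" where
  "F_classifier p reg \<mu>\<^sub>P \<mu>\<^sub>N S\<^sub>P S\<^sub>N a =
     matrix_inv (A_mat p reg \<mu>\<^sub>P \<mu>\<^sub>N S\<^sub>P S\<^sub>N a) *v b_vec p \<mu>\<^sub>P \<mu>\<^sub>N a"

definition p_hat_P :: "real^'n \<Rightarrow> real^'n^'n \<Rightarrow> real^'n \<Rightarrow> real" where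
  "p_hat_P \<mu>\<^sub>P S\<^sub>P \<theta> = measure (gaussian \<mu>\<^sub>P S\<^sub>P) {x. \<theta> \<bullet> x \<ge> 0}"

definition p_hat_N :: "real^'n \<Rightarrow> real^'n^'n \<Rightarrow> real^'n \<Rightarrow> real" where
  "p_hat_N \<mu>\<^sub>N S\<^sub>N \<theta> = measure (gaussian \<mu>\<^sub>N S\<^sub>N) {x. \<theta> \<bullet> x < 0}"

text \<open>
  The projection of the velocity component \<open>v\<close> at the coordinate value \<open>a\<close>; it is only used
  for \<open>a \<in> {0..1}\<close>.
\<close>

definition proj_velocity :: "real \<Rightarrow> real \<Rightarrow> real" where
  "proj_velocity a v = (if a = 0 then max v 0 else if a = 1 then min v 0 else v)"

definition reduced_field ::
  "real \<Rightarrow> real \<Rightarrow> real^'n \<Rightarrow> real^'n \<Rightarrow> real^'n^'n \<Rightarrow> real^'n^'n \<Rightarrow> real \<times> real \<Rightarrow> real \<times> real" where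
  "reduced_field p reg \<mu>\<^sub>P \<mu>\<^sub>N S\<^sub>P S\<^sub>N a =
     (let \<theta> = F_classifier p reg \<mu>\<^sub>P \<mu>\<^sub>N S\<^sub>P S\<^sub>N a in
       (proj_velocity (fst a) (p * fst a * (2 * p_hat_P \<mu>\<^sub>P S\<^sub>P \<theta> - 1)),
        proj_velocity (snd a) ((1 - p) * snd a * (2 * p_hat_N \<mu>\<^sub>N S\<^sub>N \<theta> - 1))))"

text \<open>
  Absolute continuity of a function on a set of reals. Degenerate intervals \<open>(u, u)\<close> are
  harmless, and disjointness is required of the open intervals, so neighbours may share an endpoint.
\<close>

definition abs_continuous_on :: "real set \<Rightarrow> (real \<Rightarrow> 'a::real_normed_vector) \<Rightarrow> bool" where
  "abs_continuous_on S f \<longleftrightarrow>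
     (\<forall>\<epsilon>>0. \<exists>\<delta>>0. \<forall>D.
        finite D \<and> (\<forall>(u, v)\<in>D. u \<le> v \<and> {u..v} \<subseteq> S) \<and>
        disjoint_family_on (\<lambda>(u, v). {u<..<v}) D \<and> (\<Sum>(u, v)\<in>D. v - u) < \<delta>
        \<longrightarrow> (\<Sum>(u, v)\<in>D. norm (f v - f u)) < \<epsilon>)"

text \<open>
  On the unbounded time axis, absolute continuity means absolute continuity on every compact
  time interval.
\<close>

definition reduced_solution ::
  "real \<Rightarrow> real \<Rightarrow> real^'n \<Rightarrow> real^'n \<Rightarrow> real^'n^'n \<Rightarrow> real^'n^'n \<Rightarrow> (real \<Rightarrow> real \<times> real) \<Rightarrow> bool" where
  "reduced_solution p reg \<mu>\<^sub>P \<mu>\<^sub>N S\<^sub>P S\<^sub>N \<alpha> \<longleftrightarrow>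
     \<alpha> ` {0..} \<subseteq> {0..1} \<times> {0..1} \<and>
     (\<forall>T\<ge>0. abs_continuous_on {0..T} \<alpha>) \<and>
     (AE t in lebesgue. t \<ge> 0 \<longrightarrow>
        (\<alpha> has_vector_derivative reduced_field p reg \<mu>\<^sub>P \<mu>\<^sub>N S\<^sub>P S\<^sub>N (\<alpha> t)) (at t within {0..}))"

end

theory Submission
  imports Defs
begin

text \<open>
  Put \<open>x = p \<alpha>\<^sub>1\<close> and \<open>y = (1 - p) \<alpha>\<^sub>-\<^sub>1\<close>. Near the origin \<open>\<theta>\<close> is close to
  \<open>(x \<mu>\<^sub>P - y \<mu>\<^sub>N) / reg\<close>. If \<open>\<parallel>\<mu>\<^sub>P\<parallel> x \<ge> \<parallel>\<mu>\<^sub>N\<parallel> y\<close>, strict Cauchy--Schwarz gives \<open>\<theta> \<bullet> \<mu>\<^sub>P > 0\<close>, so by symmetry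
  of the Gaussian class \<open>P\<close> is classified correctly with probability at least one half and \<open>x\<close> does
  not decrease; in the opposite case \<open>y\<close> does not decrease. Hence
  \<open>V = min (max (\<parallel>\<mu>\<^sub>P\<parallel> x) (\<parallel>\<mu>\<^sub>N\<parallel> y)) c\<close> with small \<open>c\<close> is absolutely continuous with
  nonnegative slope almost everywhere along a solution, so it is nondecreasing, while it is positive
  initially and vanishes at the origin.
\<close>

subsection \<open>Monotonicity of absolutely continuous functions\<close>

text \<open>Both lower one-sided Dini derivatives of f at t, relative to S, are at least 0. Unlike a
  derivative, this notion survives the kinks of \<open>max\<close> and \<open>min\<close>, and it
  still suffices for monotonicity of absolutely continuous functions.\<close>

definition nonneg_slope_at :: "(real \<Rightarrow> real) \<Rightarrow> real set \<Rightarrow> real \<Rightarrow> bool" where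
  "nonneg_slope_at f S t \<longleftrightarrow>
     (\<forall>\<epsilon>>0. \<forall>\<^sub>F w in at t within S.
        (t \<le> w \<longrightarrow> f t - \<epsilon> * (w - t) \<le> f w) \<and> (w \<le> t \<longrightarrow> f w \<le> f t + \<epsilon> * (t - w)))"

lemma has_real_derivative_nonneg_slope_at:
  assumes "(f has_real_derivative f') (at t within S)" and "0 \<le> f'"
  shows "nonneg_slope_at f S t"
  unfolding nonneg_slope_at_def
proof (intro allI impI)
  fix \<epsilon> :: real
  assume "\<epsilon> > 0"
  have "((\<lambda>w. (f w - f t) / (w - t)) \<longlongrightarrow> f') (at t within S)"
    using assms(1) by (simp add: has_field_derivative_iff)
  then have "\<forall>\<^sub>F w in at t within S. - \<epsilon> < (f w - f t) / (w - t)"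
    using \<open>\<epsilon> > 0\<close> \<open>0 \<le> f'\<close> by (intro order_tendstoD(1)) auto
  then show "\<forall>\<^sub>F w in at t within S.
      (t \<le> w \<longrightarrow> f t - \<epsilon> * (w - t) \<le> f w) \<and> (w \<le> t \<longrightarrow> f w \<le> f t + \<epsilon> * (t - w))"
    by (rule eventually_mono) (auto simp: divide_simps algebra_simps split: if_splits)
qed

lemma nonneg_slope_at_cong:
  assumes "nonneg_slope_at f S t" and "\<forall>\<^sub>F w in at t within S. g w = f w" and "g t = f t"
  shows "nonneg_slope_at g S t"
  using assms unfolding nonneg_slope_at_def by (fastforce elim: eventually_elim2)

lemma nonneg_slope_at_const: "nonneg_slope_at (\<lambda>_. c) S t"
  unfolding nonneg_slope_at_def by (auto intro!: always_eventually)

lemma nonneg_slope_at_max: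
  assumes "nonneg_slope_at f S t" and "nonneg_slope_at g S t"
  shows "nonneg_slope_at (\<lambda>w. max (f w) (g w)) S t"
  unfolding nonneg_slope_at_def
proof (intro allI impI)
  fix \<epsilon> :: real
  assume "\<epsilon> > 0"
  from assms(1)[unfolded nonneg_slope_at_def, rule_format, OF this]
       assms(2)[unfolded nonneg_slope_at_def, rule_format, OF this]
  show "\<forall>\<^sub>F w in at t within S.
      (t \<le> w \<longrightarrow> max (f t) (g t) - \<epsilon> * (w - t) \<le> max (f w) (g w)) \<and>
      (w \<le> t \<longrightarrow> max (f w) (g w) \<le> max (f t) (g t) + \<epsilon> * (t - w))"
    by eventually_elim (auto simp: max_def)
qed

lemma nonneg_slope_at_min:
  assumes "nonneg_slope_at f S t" and "nonneg_slope_at g S t"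
  shows "nonneg_slope_at (\<lambda>w. min (f w) (g w)) S t"
  unfolding nonneg_slope_at_def
proof (intro allI impI)
  fix \<epsilon> :: real
  assume "\<epsilon> > 0"
  from assms(1)[unfolded nonneg_slope_at_def, rule_format, OF this]
       assms(2)[unfolded nonneg_slope_at_def, rule_format, OF this]
  show "\<forall>\<^sub>F w in at t within S.
      (t \<le> w \<longrightarrow> min (f t) (g t) - \<epsilon> * (w - t) \<le> min (f w) (g w)) \<and>
      (w \<le> t \<longrightarrow> min (f w) (g w) \<le> min (f t) (g t) + \<epsilon> * (t - w))"
    by eventually_elim (auto simp: min_def)
qed

text \<open>Near t a strictly larger branch is the maximum, so only the dominant branch needs a
  nonnegative derivative; at a tie both do. Above level c the truncated function is locally
  constant. Hence the derivative hypotheses concern only points where the maximum is at most c,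
  which is what localises the argument to a neighbourhood of the origin.\<close>

lemma nonneg_slope_at_min_max:
  assumes f: "(f has_real_derivative f') (at t within S)"
    and g: "(g has_real_derivative g') (at t within S)"
    and f': "max (f t) (g t) \<le> c \<Longrightarrow> g t \<le> f t \<Longrightarrow> 0 \<le> f'"
    and g': "max (f t) (g t) \<le> c \<Longrightarrow> f t \<le> g t \<Longrightarrow> 0 \<le> g'"
  shows "nonneg_slope_at (\<lambda>w. min (max (f w) (g w)) c) S t"
proof -
  have lim: "(f \<longlongrightarrow> f t) (at t within S)" "(g \<longlongrightarrow> g t) (at t within S)"
    using DERIV_continuous f g by (auto simp: continuous_within)
  have max_slope: "nonneg_slope_at (\<lambda>w. max (f w) (g w)) S t" if "max (f t) (g t) \<le> c"
  proof -
    consider "f t = g t" | "g t < f t" | "f t < g t" by linarith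
    then show ?thesis
    proof cases
      case 1
      then show ?thesis
        using that f' g' has_real_derivative_nonneg_slope_at[OF f] has_real_derivative_nonneg_slope_at[OF g]
        by (intro nonneg_slope_at_max) auto
    next
      case 2
      have "\<forall>\<^sub>F w in at t within S. 0 < f w - g w"
        using 2 by (intro order_tendstoD(1)[OF tendsto_diff[OF lim]]) auto
      then have "\<forall>\<^sub>F w in at t within S. max (f w) (g w) = f w"
        by (rule eventually_mono) auto
      then show ?thesis
        using 2 that f f'
        by (intro nonneg_slope_at_cong[OF has_real_derivative_nonneg_slope_at[OF f]]) auto
    next
      case 3
      have "\<forall>\<^sub>F w in at t within S. f w - g w < 0"
        using 3 by (intro order_tendstoD(2)[OF tendsto_diff[OF lim]]) auto
      then have "\<forall>\<^sub>F w in at t within S. max (f w) (g w) = g w"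
        by (rule eventually_mono) auto
      then show ?thesis
        using 3 that g g'
        by (intro nonneg_slope_at_cong[OF has_real_derivative_nonneg_slope_at[OF g]]) auto
    qed
  qed
  show ?thesis
  proof (cases "max (f t) (g t) \<le> c")
    case True
    then show ?thesis
      using nonneg_slope_at_min[OF max_slope nonneg_slope_at_const] by simp
  next
    case False
    have "\<forall>\<^sub>F w in at t within S. c < max (f w) (g w)"
      using False by (intro order_tendstoD(1)[OF tendsto_max[OF lim]]) auto
    then have "\<forall>\<^sub>F w in at t within S. min (max (f w) (g w)) c = c"
      by (rule eventually_mono) auto
    then show ?thesis
      using False by (intro nonneg_slope_at_cong[OF nonneg_slope_at_const]) auto
  qed
qed

text \<open>
  Cousin's lemma supplies a tagged partition that is fine both for the slope condition and for a
  small open cover of the exceptional set; absolute continuity makes the exceptional part negligible.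
\<close>

lemma abs_continuous_on_nonneg_slope_imp_le:
  fixes f :: "real \<Rightarrow> real"
  assumes "a \<le> b" and ac: "abs_continuous_on {a..b} f"
    and ae: "AE t in lebesgue. t \<in> {a..b} \<longrightarrow> nonneg_slope_at f {a..b} t"
  shows "f a \<le> f b"
proof (rule field_le_epsilon)
  fix e0 :: real
  assume "e0 > 0"
  \<comment> \<open>The final error is e * (b - a) from the slope inequalities plus e from the
    exceptional tags, together e0. The summand 1 keeps the denominator positive when a = b.\<close>
  define e where "e = e0 / (b - a + 1)"
  have "e * (b - a + 1) = e0"
    using \<open>a \<le> b\<close> by (simp add: e_def)
  then have e: "e > 0" "e * (b - a) + e = e0"
    using \<open>e0 > 0\<close> \<open>a \<le> b\<close> by (simp_all add: e_def distrib_left)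
  obtain \<delta> where "\<delta> > 0" and \<delta>: "\<forall>D. finite D \<and> (\<forall>(u, v)\<in>D. u \<le> v \<and> {u..v} \<subseteq> {a..b}) \<and>
      disjoint_family_on (\<lambda>(u, v). {u<..<v}) D \<and> (\<Sum>(u, v)\<in>D. v - u) < \<delta>
      \<longrightarrow> (\<Sum>(u, v)\<in>D. norm (f v - f u)) < e"
    using ac[unfolded abs_continuous_on_def, rule_format, OF \<open>e > 0\<close>] by blast
  obtain N where N: "negligible N"
    and slope: "\<And>t. t \<in> {a..b} \<Longrightarrow> t \<notin> N \<Longrightarrow> nonneg_slope_at f {a..b} t"
    using ae unfolding eventually_ae_filter_negligible by blast
  have "N \<in> null_sets lebesgue"
    using N negligible_iff_null_sets by blast
  \<comment> \<open>Outer regularity controls \<open>U - N\<close>; since N is null, U itself has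
    measure below \<delta>.\<close>
  obtain U where U: "open U" "N \<subseteq> U" "U \<in> lmeasurable" "measure lebesgue U < \<delta>"
  proof -
    obtain U where "open U" "N \<subseteq> U" and UN: "U - N \<in> lmeasurable" "emeasure lebesgue (U - N) < ennreal \<delta>"
      using sets_lebesgue_outer_open[OF null_setsD2[OF \<open>N \<in> null_sets lebesgue\<close>] \<open>\<delta> > 0\<close>] by metis
    have "emeasure lebesgue U < ennreal \<delta>"
      using UN(2) emeasure_Diff_null_set[OF \<open>N \<in> null_sets lebesgue\<close>, of U] \<open>open U\<close> by simp
    moreover have "emeasure lebesgue U < top"
      using calculation ennreal_less_top less_trans by blast
    then have "U \<in> lmeasurable"
      using \<open>open U\<close> by (intro fmeasurableI) auto
    ultimately show thesis
      using that \<open>open U\<close> \<open>N \<subseteq> U\<close> \<open>\<delta> > 0\<close> by (simp add: emeasure_eq_measure2 ennreal_less_iff)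
  qed
  have "\<exists>d>0. \<forall>w\<in>{a..b}. \<bar>w - t\<bar> < d \<longrightarrow>
      (t \<le> w \<longrightarrow> f t - e * (w - t) \<le> f w) \<and> (w \<le> t \<longrightarrow> f w \<le> f t + e * (t - w))"
    if t: "t \<in> {a..b} - N" for t
  proof -
    have "\<forall>\<^sub>F w in at t within {a..b}.
        (t \<le> w \<longrightarrow> f t - e * (w - t) \<le> f w) \<and> (w \<le> t \<longrightarrow> f w \<le> f t + e * (t - w))"
      using slope t \<open>e > 0\<close> unfolding nonneg_slope_at_def by blast
    then obtain d where "d > 0" and d: "\<forall>w\<in>{a..b}. w \<noteq> t \<and> dist w t < d \<longrightarrow>
        (t \<le> w \<longrightarrow> f t - e * (w - t) \<le> f w) \<and> (w \<le> t \<longrightarrow> f w \<le> f t + e * (t - w))"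
      unfolding eventually_at by blast
    show ?thesis
    proof (intro exI[of _ d] conjI ballI impI \<open>d > 0\<close>)
      fix w
      assume "w \<in> {a..b}" "\<bar>w - t\<bar> < d"
      then show "f t - e * (w - t) \<le> f w" if "t \<le> w"
        using d that by (cases "w = t") (auto simp: dist_real_def)
      show "f w \<le> f t + e * (t - w)" if "w \<le> t"
        using d that \<open>w \<in> {a..b}\<close> \<open>\<bar>w - t\<bar> < d\<close> by (cases "w = t") (auto simp: dist_real_def)
    qed
  qed
  then obtain d where d: "\<And>t. t \<in> {a..b} - N \<Longrightarrow> d t > 0"
    "\<And>t w. t \<in> {a..b} - N \<Longrightarrow> w \<in> {a..b} \<Longrightarrow> \<bar>w - t\<bar> < d t \<Longrightarrow>
      (t \<le> w \<longrightarrow> f t - e * (w - t) \<le> f w) \<and> (w \<le> t \<longrightarrow> f w \<le> f t + e * (t - w))"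
    by metis
  \<comment> \<open>An interval tagged in N is forced into the small open set U; an interval tagged
    in {a..b} outside N stays within the radius where the slope inequalities hold at its
    tag.\<close>
  define \<gamma> where "\<gamma> t = (if t \<in> N then U else if t \<in> {a..b} then ball t (d t) else UNIV)" for t
  have "gauge \<gamma>"
    using U d(1) by (auto simp: gauge_def \<gamma>_def)
  then obtain P where P: "P tagged_division_of {a..b}" "\<gamma> fine P"
    using fine_division_exists_real by blast
  note PD = tagged_division_ofD[OF P(1)]
  have K: "Inf K \<le> x \<and> x \<le> Sup K \<and> K = {Inf K..Sup K} \<and> K \<subseteq> {a..b} \<and> K \<subseteq> \<gamma> x"
    if xK: "(x, K) \<in> P" for x K
  proof -
    have "K \<subseteq> \<gamma> x"
      using P(2) xK by (auto simp: fine_def)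
    moreover obtain u v where "K = {u..v}"
      using PD(4)[OF xK] by auto
    ultimately show ?thesis
      using PD(2,3)[OF xK] by auto
  qed
  \<comment> \<open>The intervals with exceptional tags, to be fed to absolute continuity.
    Degenerate ones have zero increment and are dropped, so that the remaining interiors are
    nonempty and disjoint; this makes \<open>ends\<close> injective.\<close>
  define P' where "P' = {(x, K) \<in> P. x \<in> N \<and> Inf K < Sup K}"
  have "P' \<subseteq> P" by (auto simp: P'_def)
  define ends where "ends = (\<lambda>(x::real, K::real set). (Inf K, Sup K))"
  have disj: "{Inf K<..<Sup K} \<inter> {Inf K'<..<Sup K'} = {}"
    if "(x, K) \<in> P" "(x', K') \<in> P" "(x, K) \<noteq> (x', K')" for x K x' K'
  proof -
    have "interior K = {Inf K<..<Sup K}" "interior K' = {Inf K'<..<Sup K'}"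
      using K[OF that(1)] K[OF that(2)] interior_atLeastAtMost_real by metis+
    then show ?thesis
      using PD(5)[OF that] by simp
  qed
  have inj: "inj_on ends P'"
  proof (rule inj_onI, rule ccontr)
    fix y z
    assume y: "y \<in> P'" and z: "z \<in> P'" and eq: "ends y = ends z" and ne: "y \<noteq> z"
    obtain x K x' K' where yz: "y = (x, K)" "z = (x', K')"
      by (metis surj_pair)
    have "{Inf K<..<Sup K} \<inter> {Inf K'<..<Sup K'} = {}"
      using disj[of x K x' K'] y z ne \<open>P' \<subseteq> P\<close> yz by auto
    then show False
      using eq y by (auto simp: yz ends_def P'_def)
  qed
  have D_disj: "disjoint_family_on (\<lambda>(u, v). {u<..<v}) (ends ` P')"
    unfolding disjoint_family_on_def
  proof (intro ballI impI)
    fix m n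
    assume "m \<in> ends ` P'" "n \<in> ends ` P'" "m \<noteq> n"
    then obtain x K x' K' where "(x, K) \<in> P'" "(x', K') \<in> P'" "m = (Inf K, Sup K)" "n = (Inf K', Sup K')"
      by (auto simp: ends_def)
    then show "(case m of (u, v) \<Rightarrow> {u<..<v}) \<inter> (case n of (u, v) \<Rightarrow> {u<..<v}) = {}"
      using disj[of x K x' K'] \<open>P' \<subseteq> P\<close> \<open>m \<noteq> n\<close> by auto
  qed
  have "finite P'"
    using PD(1) \<open>P' \<subseteq> P\<close> finite_subset by blast
  have D_in: "\<forall>(u, v)\<in>ends ` P'. u \<le> v \<and> {u..v} \<subseteq> {a..b}"
    using K \<open>P' \<subseteq> P\<close> by (fastforce simp: ends_def)
  have "(\<Sum>(u, v)\<in>ends ` P'. v - u) = (\<Sum>(u, v)\<in>ends ` P'. measure lebesgue {u<..<v})"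
    using D_in by (intro sum.cong) auto
  also have "\<dots> = measure lebesgue (\<Union>(u, v)\<in>ends ` P'. {u<..<v})"
    using \<open>finite P'\<close> D_disj D_in
    by (subst measure_finite_Union) (auto simp: case_prod_beta)
  also have "\<dots> \<le> measure lebesgue U"
  proof (rule measure_mono_fmeasurable[OF _ _ U(3)])
    show "(\<Union>(u, v)\<in>ends ` P'. {u<..<v}) \<subseteq> U"
    proof
      fix w
      assume "w \<in> (\<Union>(u, v)\<in>ends ` P'. {u<..<v})"
      then obtain x K where xK: "(x, K) \<in> P'" and w: "w \<in> {Inf K..Sup K}"
        by (auto simp: ends_def)
      then have "K \<subseteq> U" "K = {Inf K..Sup K}"
        using K[of x K] by (auto simp: P'_def \<gamma>_def)
      then show "w \<in> U"
        using w by blast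
    qed
    show "(\<Union>(u, v)\<in>ends ` P'. {u<..<v}) \<in> sets lebesgue"
      using \<open>finite P'\<close> by (intro sets.finite_UN) auto
  qed
  also have "\<dots> < \<delta>" by (rule U(4))
  finally have "(\<Sum>(u, v)\<in>ends ` P'. norm (f v - f u)) < e"
    using \<delta> \<open>finite P'\<close> D_in D_disj by blast
  also have "(\<Sum>(u, v)\<in>ends ` P'. norm (f v - f u)) = (\<Sum>(x, K)\<in>P'. \<bar>f (Sup K) - f (Inf K)\<bar>)"
    by (subst sum.reindex[OF inj]) (auto simp: ends_def case_prod_beta intro: sum.cong)
  finally have small: "(\<Sum>(x, K)\<in>P'. \<bar>f (Sup K) - f (Inf K)\<bar>) < e" .
  \<comment> \<open>For a tag outside N the interval is split at the tag: the two one-sided slope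
    inequalities at x, taken at \<open>Inf K\<close> and \<open>Sup K\<close>, add up to an error of
    e times the length. For a tag in N the bound is just -|z| \<le> z.\<close>
  have bound: "- e * (Sup K - Inf K) - (if (x, K) \<in> P' then \<bar>f (Sup K) - f (Inf K)\<bar> else 0)
      \<le> f (Sup K) - f (Inf K)" if xK: "(x, K) \<in> P" for x K
  proof (cases "x \<in> N")
    case True
    have "0 \<le> e * (Sup K - Inf K)" "\<not> Inf K < Sup K \<Longrightarrow> Inf K = Sup K"
      using K[OF xK] \<open>e > 0\<close> by (auto intro: mult_nonneg_nonneg)
    then show ?thesis
      using True xK by (cases "Inf K < Sup K") (auto simp: P'_def)
  next
    case False
    have x: "x \<in> {a..b} - N"
      using PD(2,3)[OF xK] False by auto
    have "Inf K \<in> K" "Sup K \<in> K"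
      using K[OF xK] by (metis atLeastAtMost_iff order.refl order.trans)+
    then have "Inf K \<in> {a..b}" "\<bar>Inf K - x\<bar> < d x" "Sup K \<in> {a..b}" "\<bar>Sup K - x\<bar> < d x"
      using K[OF xK] x by (auto simp: \<gamma>_def dist_real_def)
    then show ?thesis
      using d(2)[OF x, of "Inf K"] d(2)[OF x, of "Sup K"] K[OF xK] False
      by (auto simp: P'_def algebra_simps)
  qed
  \<comment> \<open>Summing over the tagged division telescopes: lengths add up to b - a, increments
    of f to f b - f a.\<close>
  have "- e * (b - a) - (\<Sum>(x, K)\<in>P'. \<bar>f (Sup K) - f (Inf K)\<bar>) =
      - e * (\<Sum>(x, K)\<in>P. Sup K - Inf K) - (\<Sum>(x, K)\<in>P. if (x, K) \<in> P' then \<bar>f (Sup K) - f (Inf K)\<bar> else 0)"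
  proof -
    have "(\<Sum>(x, K)\<in>P. if (x, K) \<in> P' then \<bar>f (Sup K) - f (Inf K)\<bar> else 0) =
        (\<Sum>(x, K)\<in>P'. \<bar>f (Sup K) - f (Inf K)\<bar>)"
      using PD(1) \<open>P' \<subseteq> P\<close> by (intro sum.mono_neutral_cong_right) auto
    then show ?thesis
      using additive_tagged_division_1[OF \<open>a \<le> b\<close> P(1), of "\<lambda>x. x"] by simp
  qed
  also have "\<dots> = (\<Sum>(x, K)\<in>P. - e * (Sup K - Inf K) -
      (if (x, K) \<in> P' then \<bar>f (Sup K) - f (Inf K)\<bar> else 0))"
    by (simp add: case_prod_beta sum_subtractf sum_distrib_left sum_negf right_diff_distrib)
  also have "\<dots> \<le> (\<Sum>(x, K)\<in>P. f (Sup K) - f (Inf K))"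
    using bound by (intro sum_mono) auto
  also have "\<dots> = f b - f a"
    by (rule additive_tagged_division_1[OF \<open>a \<le> b\<close> P(1)])
  finally show "f a \<le> f b + e0"
    using small e by simp
qed

text \<open>Transfers absolute continuity from the solution to a Lipschitz function of it, here the
  truncated maximum V.\<close>

lemma abs_continuous_on_lipschitz:
  fixes f :: "real \<Rightarrow> 'a::real_normed_vector" and g :: "real \<Rightarrow> 'b::real_normed_vector"
  assumes f: "abs_continuous_on S f"
    and le: "\<And>u v. u \<in> S \<Longrightarrow> v \<in> S \<Longrightarrow> norm (g v - g u) \<le> L * norm (f v - f u)"
  shows "abs_continuous_on S g"
  unfolding abs_continuous_on_def
proof (intro allI impI)
  fix \<epsilon> :: real
  assume "\<epsilon> > 0"
  \<comment> \<open>L is arbitrary; the maximum with 1 makes the division of \<epsilon>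
    legitimate.\<close>
  define M where "M = max L 1"
  have "M > 0" by (simp add: M_def)
  then have "\<epsilon> / M > 0" using \<open>\<epsilon> > 0\<close> by simp
  obtain \<delta> where "\<delta> > 0" and \<delta>: "\<forall>D. finite D \<and> (\<forall>(u, v)\<in>D. u \<le> v \<and> {u..v} \<subseteq> S) \<and>
      disjoint_family_on (\<lambda>(u, v). {u<..<v}) D \<and> (\<Sum>(u, v)\<in>D. v - u) < \<delta>
      \<longrightarrow> (\<Sum>(u, v)\<in>D. norm (f v - f u)) < \<epsilon> / M"
    using f[unfolded abs_continuous_on_def, rule_format, OF \<open>\<epsilon> / M > 0\<close>] by blast
  show "\<exists>\<delta>>0. \<forall>D. finite D \<and> (\<forall>(u, v)\<in>D. u \<le> v \<and> {u..v} \<subseteq> S) \<and>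
        disjoint_family_on (\<lambda>(u, v). {u<..<v}) D \<and> (\<Sum>(u, v)\<in>D. v - u) < \<delta>
        \<longrightarrow> (\<Sum>(u, v)\<in>D. norm (g v - g u)) < \<epsilon>"
  proof (intro exI[of _ \<delta>] conjI allI impI \<open>\<delta> > 0\<close>)
    fix D
    assume D: "finite D \<and> (\<forall>(u, v)\<in>D. u \<le> v \<and> {u..v} \<subseteq> S) \<and>
        disjoint_family_on (\<lambda>(u, v). {u<..<v}) D \<and> (\<Sum>(u, v)\<in>D. v - u) < \<delta>"
    have "norm (g v - g u) \<le> M * norm (f v - f u)" if "(u, v) \<in> D" for u v
    proof -
      have "u \<in> S" "v \<in> S" using D that by (auto simp: subset_iff)
      then have "norm (g v - g u) \<le> L * norm (f v - f u)" by (rule le)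
      also have "\<dots> \<le> M * norm (f v - f u)"
        by (intro mult_right_mono) (auto simp: M_def)
      finally show ?thesis .
    qed
    then have "(\<Sum>(u, v)\<in>D. norm (g v - g u)) \<le> M * (\<Sum>(u, v)\<in>D. norm (f v - f u))"
      unfolding sum_distrib_left by (intro sum_mono) auto
    also have "\<dots> < M * (\<epsilon> / M)"
      using \<delta> D \<open>M > 0\<close> by (intro mult_strict_left_mono) auto
    finally show "(\<Sum>(u, v)\<in>D. norm (g v - g u)) < \<epsilon>"
      using \<open>M > 0\<close> by simp
  qed
qed

subsection \<open>Linear change of variables and Gaussian half-spaces\<close>

lemma nn_integral_lborel_insert_Basis:
  fixes f :: "'a::euclidean_space \<Rightarrow> ennreal"
  assumes [measurable]: "f \<in> borel_measurable borel" and b: "b \<in> Basis"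
  shows "(\<integral>\<^sup>+x. f x \<partial>lborel) =
    (\<integral>\<^sup>+z. \<integral>\<^sup>+y. f ((\<Sum>c\<in>Basis - {b}. z c *\<^sub>R c) + y *\<^sub>R b) \<partial>lborel \<partial>(\<Pi>\<^sub>M c\<in>Basis - {b}. lborel))"
proof -
  interpret product_sigma_finite "\<lambda>_::'a. lborel :: real measure" ..
  have Basis: "Basis = insert b (Basis - {b})" using b by auto
  have "(\<integral>\<^sup>+x. f x \<partial>lborel) = (\<integral>\<^sup>+z. f (\<Sum>c\<in>Basis. z c *\<^sub>R c) \<partial>(\<Pi>\<^sub>M c\<in>Basis. lborel))"
    by (subst lborel_eq) (simp add: nn_integral_distr)
  also have "\<dots> = (\<integral>\<^sup>+z. f (\<Sum>c\<in>Basis. z c *\<^sub>R c) \<partial>(\<Pi>\<^sub>M c\<in>insert b (Basis - {b}). lborel))"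
    using Basis by simp
  also have "\<dots> = (\<integral>\<^sup>+z. \<integral>\<^sup>+y. f (\<Sum>c\<in>Basis. (z(b := y)) c *\<^sub>R c) \<partial>lborel \<partial>(\<Pi>\<^sub>M c\<in>Basis - {b}. lborel))"
    by (rule product_nn_integral_insert) (use Basis in \<open>auto simp flip: Basis\<close>)
  finally show ?thesis
    by (simp add: sum.remove[OF _ b] add.commute)
qed

text \<open>Since l does not depend on the coordinate along b, the map is a translation on each line
  parallel to b. Integrating along b first, translation invariance of the one-dimensional integral
  gives the claim.\<close>

lemma nn_integral_lborel_shear:
  fixes f :: "'a::euclidean_space \<Rightarrow> ennreal" and l :: "'a \<Rightarrow> real"
  assumes [measurable]: "f \<in> borel_measurable borel" "l \<in> borel_measurable borel"
    and b: "b \<in> Basis" and l: "\<And>x y. l (x + y *\<^sub>R b) = l x"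
  shows "(\<integral>\<^sup>+x. f (x + l x *\<^sub>R b) \<partial>lborel) = (\<integral>\<^sup>+x. f x \<partial>lborel)"
proof -
  have shift: "(\<integral>\<^sup>+y. f (w + y *\<^sub>R b + l (w + y *\<^sub>R b) *\<^sub>R b) \<partial>lborel) =
      (\<integral>\<^sup>+y. f (w + y *\<^sub>R b) \<partial>lborel)" for w
  proof -
    have "(\<integral>\<^sup>+y. f (w + y *\<^sub>R b) \<partial>lborel) = (\<integral>\<^sup>+y. f (w + (l w + 1 * y) *\<^sub>R b) \<partial>lborel)"
      by (subst nn_integral_real_affine[where c = 1 and t = "l w"]) auto
    then show ?thesis
      by (simp add: l algebra_simps)
  qed
  show ?thesis
    by (simp add: nn_integral_lborel_insert_Basis[OF _ b] shift)
qed

lemma prod_Basis_cart: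
  fixes f :: "real^'n \<Rightarrow> 'b::comm_monoid_mult"
  shows "(\<Prod>b\<in>Basis. f b) = (\<Prod>i\<in>UNIV. f (axis i (1::real)))"
proof -
  have "Basis = range (\<lambda>i. axis i (1::real) :: real^'n)"
    by (auto simp: Basis_vec_def)
  moreover have "inj (\<lambda>i. axis i (1::real) :: real^'n)"
    by (auto simp: inj_on_def axis_eq_axis)
  ultimately show ?thesis
    using prod.reindex[of "\<lambda>i. axis i (1::real) :: real^'n" UNIV f] by (simp add: o_def)
qed

text \<open>Lebesgue measure is determined by its values on boxes, and the preimage of a box is the
  box with permuted side lengths, which has the same volume.\<close>

lemma lborel_distr_permute:
  fixes \<pi> :: "'n::finite \<Rightarrow> 'n"
  assumes \<pi>: "\<pi> permutes UNIV"
  shows "distr lborel borel (\<lambda>x::real^'n. \<chi> i. x $ \<pi> i) = lborel"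
proof (rule lborel_eqI[symmetric])
  have [measurable]: "(\<lambda>x::real^'n. \<chi> i. x $ \<pi> i) \<in> borel \<rightarrow>\<^sub>M borel"
    by (intro borel_measurable_continuous_onI continuous_on_vec_lambda continuous_intros)
  fix l u :: "real^'n"
  assume lu: "\<And>b. b \<in> Basis \<Longrightarrow> l \<bullet> b \<le> u \<bullet> b"
  have lu': "l $ i \<le> u $ i" for i
    using lu[of "axis i 1"] by (simp add: inner_axis)
  have bij: "bij \<pi>" using \<pi> by (simp add: permutes_bij)
  have eq: "(\<lambda>x. \<chi> i. x $ \<pi> i) -` box l u = box (\<chi> i. l $ inv \<pi> i) (\<chi> i. u $ inv \<pi> i)"
  proof -
    have "(\<forall>j. Q j) \<longleftrightarrow> (\<forall>i. Q (\<pi> i))" for Q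
      using bij_is_surj[OF bij] by (metis surjD)
    from this[of "\<lambda>j. l $ inv \<pi> j < x $ j \<and> x $ j < u $ inv \<pi> j" for x :: "real^'n"]
    show ?thesis
      by (simp add: set_eq_iff mem_box_cart permutes_inverses[OF \<pi>])
  qed
  have "emeasure (distr lborel borel (\<lambda>x. \<chi> i. x $ \<pi> i)) (box l u) = (\<Prod>i\<in>UNIV. (u - l) $ inv \<pi> i)"
  proof -
    have "(\<chi> i. l $ inv \<pi> i) \<bullet> b \<le> (\<chi> i. u $ inv \<pi> i) \<bullet> b" if "b \<in> Basis" for b
      using that lu' by (auto simp: Basis_vec_def inner_axis)
    then show ?thesis
      by (simp add: emeasure_distr eq prod_Basis_cart inner_axis)
  qed
  also have "(\<Prod>i\<in>UNIV. (u - l) $ inv \<pi> i) = (\<Prod>i\<in>UNIV. (u - l) $ i)"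
    by (rule prod.permute[OF permutes_inv[OF \<pi>], unfolded o_def, symmetric])
  finally show "emeasure (distr lborel borel (\<lambda>x. \<chi> i. x $ \<pi> i)) (box l u) = (\<Prod>b\<in>Basis. (u - l) \<bullet> b)"
    by (simp add: prod_Basis_cart inner_axis)
qed simp

lemma borel_measurable_matrix_vector_mult [measurable (raw)]:
  fixes A :: "real^'n^'m"
  assumes "f \<in> borel_measurable M"
  shows "(\<lambda>x. A *v f x) \<in> borel_measurable M"
proof -
  have "(*v) A \<in> borel \<rightarrow>\<^sub>M borel"
    by (intro borel_measurable_continuous_onI continuous_intros)
  then show ?thesis
    using assms by (rule measurable_compose[rotated])
qed

text \<open>
  The change of variables theorems of HOL-Analysis require a well-ordered index type; the statement
  below needs only a finite one. Shears are handled by Fubini.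
\<close>

lemma nn_integral_lborel_matrix:
  fixes A :: "real^'n^'n" and f :: "real^'n \<Rightarrow> ennreal"
  assumes "f \<in> borel_measurable borel" and "det A \<noteq> 0"
  shows "ennreal \<bar>det A\<bar> * (\<integral>\<^sup>+x. f (A *v x) \<partial>lborel) = (\<integral>\<^sup>+x. f x \<partial>lborel)"
proof -
  \<comment> \<open>The quantifier over f is part of the induction predicate because the row
    operation case applies the hypothesis to f composed with a shear. A matrix with a zero row
    satisfies P vacuously, its determinant being 0.\<close>
  define P where "P B \<longleftrightarrow> (det B \<noteq> 0 \<longrightarrow> (\<forall>f\<in>borel_measurable borel.
      ennreal \<bar>det B\<bar> * (\<integral>\<^sup>+x. f (B *v x) \<partial>lborel) = (\<integral>\<^sup>+x. f x \<partial>lborel)))" for B :: "real^'n^'n"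
  have "P A"
  proof (rule induct_matrix_row_operations)
    show "P B" if "row i B = 0" for B i
      using that by (simp add: P_def det_zero_row)
  next
    fix B :: "real^'n^'n"
    assume diag: "\<And>i j. i \<noteq> j \<Longrightarrow> B $ i $ j = 0"
    have det: "det B = (\<Prod>i\<in>UNIV. B $ i $ i)"
      by (rule det_diagonal[OF diag])
    show "P B"
      unfolding P_def
    proof (intro impI ballI)
      fix f :: "real^'n \<Rightarrow> ennreal"
      assume nz: "det B \<noteq> 0" and [measurable]: "f \<in> borel_measurable borel"
      define c where "c b = b \<bullet> (B *v b)" for b
      have c_axis: "c (axis i 1) = B $ i $ i" for i
        by (simp add: c_def inner_axis' matrix_vector_mult_basis column_def)
      \<comment> \<open>Identifies multiplication by the diagonal matrix B with the coordinatewise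
        scaling in \<open>lborel_affine_euclidean\<close>, taken with offset 0.\<close>
      have Bx: "0 + (\<Sum>b\<in>Basis. (c b * (x \<bullet> b)) *\<^sub>R b) = B *v x" for x
      proof (rule euclidean_eqI)
        fix b :: "real^'n"
        assume b: "b \<in> Basis"
        then obtain i where i: "b = axis i 1"
          by (auto simp: Basis_vec_def)
        have "(B *v x) $ i = (\<Sum>j\<in>UNIV. if j = i then B $ i $ i * x $ i else 0)"
          unfolding matrix_vector_mult_def vec_lambda_beta
          by (intro sum.cong) (auto simp: diag)
        then show "(0 + (\<Sum>b\<in>Basis. (c b * (x \<bullet> b)) *\<^sub>R b)) \<bullet> b = (B *v x) \<bullet> b"
          using b by (simp add: inner_sum_left_Basis) (simp add: i c_axis inner_axis)
      qed
      have "c b \<noteq> 0" if "b \<in> Basis" for b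
        using that nz by (auto simp: Basis_vec_def c_axis det)
      from lborel_affine_euclidean[OF this, of "\<lambda>b. b" 0]
      have "lborel = density (distr lborel borel ((*v) B)) (\<lambda>_. ennreal (\<Prod>b\<in>Basis. \<bar>c b\<bar>))"
        by (simp only: Bx)
      also have "(\<Prod>b\<in>Basis. \<bar>c b\<bar>) = \<bar>det B\<bar>"
        by (simp add: prod_Basis_cart c_axis det abs_prod)
      finally have lb: "lborel = density (distr lborel borel ((*v) B)) (\<lambda>_. ennreal \<bar>det B\<bar>)" .
      show "ennreal \<bar>det B\<bar> * (\<integral>\<^sup>+x. f (B *v x) \<partial>lborel) = (\<integral>\<^sup>+x. f x \<partial>lborel)"
        by (subst (2) lb) (simp add: nn_integral_density nn_integral_distr nn_integral_cmult)
    qed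
  next
    fix B :: "real^'n^'n" and m n :: 'n
    assume PB: "P B" and "m \<noteq> n"
    let ?\<pi> = "Transposition.transpose m n"
    let ?B = "\<chi> i j. B $ i $ ?\<pi> j"
    have \<pi>: "?\<pi> permutes UNIV"
      by (rule permutes_swap_id) auto
    have abs_det: "\<bar>det ?B\<bar> = \<bar>det B\<bar>"
      by (simp add: det_permute_columns[OF \<pi>] abs_mult sign_def)
    \<comment> \<open>Swapping columns of B amounts to swapping coordinates of the argument first,
      and this swap preserves \<open>lborel\<close>.\<close>
    have mult: "?B *v x = B *v (\<chi> j. x $ ?\<pi> j)" for x
    proof -
      have "(\<Sum>j\<in>UNIV. B $ i $ ?\<pi> j * x $ j) = (\<Sum>j\<in>UNIV. B $ i $ j * x $ ?\<pi> j)" for i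
        by (subst sum.permute[OF \<pi>]) (simp add: o_def)
      then show ?thesis
        by (simp add: vec_eq_iff matrix_vector_mult_def)
    qed
    have [measurable]: "(\<lambda>x::real^'n. \<chi> j. x $ ?\<pi> j) \<in> borel \<rightarrow>\<^sub>M borel"
      by (intro borel_measurable_continuous_onI continuous_on_vec_lambda continuous_intros)
    have "(\<integral>\<^sup>+x. f (?B *v x) \<partial>lborel) = (\<integral>\<^sup>+x. f (B *v x) \<partial>lborel)"
      if [measurable]: "f \<in> borel_measurable borel" for f :: "real^'n \<Rightarrow> ennreal"
      unfolding mult
      by (subst (2) lborel_distr_permute[OF \<pi>, symmetric]) (simp add: nn_integral_distr)
    then show "P ?B"
      using PB abs_det unfolding P_def by (metis abs_eq_0_iff)
  next
    fix B :: "real^'n^'n" and m n :: 'n and c :: real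
    assume PB: "P B" and "m \<noteq> n"
    let ?B = "\<chi> i. if i = m then row m B + c *\<^sub>R row n B else row i B"
    have det: "det ?B = det B"
      using det_row_operation[OF \<open>m \<noteq> n\<close>, of B c] unfolding scalar_mult_eq_scaleR .
    \<comment> \<open>The row operation is B followed by a shear along axis m, whose amount depends
      on coordinate n only; m \<noteq> n makes it independent of the sheared coordinate.\<close>
    have mult: "?B *v x = B *v x + (c * (B *v x) $ n) *\<^sub>R axis m 1" for x
    proof -
      have "(?B *v x) $ i = (B *v x) $ i + (c * (B *v x) $ n) * axis m 1 $ i" for i
        by (cases "i = m")
          (simp_all add: matrix_vector_mult_def row_def axis_def sum.distrib sum_distrib_left distrib_right mult.assoc)
      then show ?thesis
        by (simp add: vec_eq_iff)
    qed
    show "P ?B"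
      unfolding P_def det
    proof (intro impI ballI)
      fix f :: "real^'n \<Rightarrow> ennreal"
      assume nz: "det B \<noteq> 0" and f[measurable]: "f \<in> borel_measurable borel"
      have [measurable]: "(\<lambda>y::real^'n. c * y $ n) \<in> borel_measurable borel"
        by (intro borel_measurable_continuous_onI continuous_intros)
      have "(\<lambda>y. f (y + (c * y $ n) *\<^sub>R axis m 1)) \<in> borel_measurable borel"
        by measurable
      then have "ennreal \<bar>det B\<bar> * (\<integral>\<^sup>+x. f (?B *v x) \<partial>lborel) =
          (\<integral>\<^sup>+y. f (y + (c * y $ n) *\<^sub>R axis m 1) \<partial>lborel)"
        using PB[unfolded P_def, rule_format, OF nz, of "\<lambda>y. f (y + (c * y $ n) *\<^sub>R axis m 1)"] by (simp only: mult)
      also have "\<dots> = (\<integral>\<^sup>+y. f y \<partial>lborel)"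
        using \<open>m \<noteq> n\<close> by (intro nn_integral_lborel_shear) (auto simp: Basis_vec_def axis_def)
      finally show "ennreal \<bar>det B\<bar> * (\<integral>\<^sup>+x. f (?B *v x) \<partial>lborel) = (\<integral>\<^sup>+y. f y \<partial>lborel)" .
    qed
  qed
  then show ?thesis
    using assms by (simp add: P_def)
qed


section \<open>Positive definite matrices and Gaussian probabilities\<close>

lemma invertible_if_pos_quadratic_form:
  fixes A :: "real^'n^'n"
  assumes "\<And>x. x \<noteq> 0 \<Longrightarrow> 0 < x \<bullet> (A *v x)"
  shows "invertible A"
  unfolding invertible_left_inverse matrix_left_invertible_ker
  using assms by (metis inner_zero_right less_irrefl)

text \<open>Gram-Schmidt for the inner product \<open>x \<bullet> (S *v y)\<close>: the columns of W
  form an orthonormal basis for it. Then W times its transpose is the inverse of S, so W can stand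
  in for a square root of that inverse.\<close>

lemma sym_pos_def_orthonormalization:
  fixes S :: "real^'n^'n"
  assumes S: "sym_pos_def S"
  obtains W :: "real^'n^'n" where "transpose W ** S ** W = mat 1"
proof -
  have pos: "0 < x \<bullet> (S *v x)" if "x \<noteq> 0" for x
    using S that by (simp add: sym_pos_def_def)
  have symm: "x \<bullet> (S *v y) = y \<bullet> (S *v x)" for x y
    using S by (metis sym_pos_def_def dot_lmul_matrix inner_commute vector_transpose_matrix)
  have "\<exists>w. \<forall>i\<in>J. \<forall>j\<in>J. w i \<bullet> (S *v w j) = (if i = j then 1 else 0)" for J :: "'n set"
    using finite[of J]
  proof (induction J rule: finite_induct)
    case (insert k J)
    then obtain w where w: "\<forall>i\<in>J. \<forall>j\<in>J. w i \<bullet> (S *v w j) = (if i = j then 1 else 0)"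
      by blast
    \<comment> \<open>The next vector must be orthogonal to every \<open>S *v w j\<close>. As k is
      not in J, these vectors span a proper subspace, so a nonzero such vector exists and only needs
      to be normalised.\<close>
    let ?T = "(\<lambda>j. S *v w j) ` J"
    have "dim ?T \<le> card J"
      by (meson card_image_le dim_le_card' finite finite_imageI le_trans)
    also have "\<dots> < CARD('n)"
      using insert.hyps by (intro psubset_card_mono) auto
    finally have "dim ?T < DIM(real^'n)"
      by simp
    then obtain x where x: "x \<noteq> 0" "\<forall>y\<in>span ?T. orthogonal x y"
      using orthogonal_to_subspace_exists by metis
    define v where "v = (1 / sqrt (x \<bullet> (S *v x))) *\<^sub>R x"
    have vv: "v \<bullet> (S *v v) = 1"
      using pos[OF x(1)] by (simp add: v_def matrix_vector_mult_scaleR power2_eq_square[symmetric] divide_simps)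
    have vw: "v \<bullet> (S *v w j) = 0" if "j \<in> J" for j
      using x(2) that by (simp add: v_def orthogonal_def span_base)
    have "w j \<bullet> (S *v v) = 0" if "j \<in> J" for j
      using vw[OF that] symm[of "w j" v] by simp
    then show ?case
      using w vv vw insert.hyps
      by (intro exI[of _ "w(k := v)"]) auto
  qed simp
  then obtain w where w: "w i \<bullet> (S *v w j) = (if i = j then 1 else 0)" for i j :: 'n
    by (metis UNIV_I)
  define W :: "real^'n^'n" where "W = (\<chi> i j. w j $ i)"
  have W_axis: "W *v axis j 1 = w j" for j
    by (simp add: W_def matrix_vector_mult_basis column_def)
  have "(transpose W ** S ** W) $ i $ j = mat 1 $ i $ j" for i j
  proof -
    have "(transpose W ** S ** W) $ i $ j = axis i 1 \<bullet> ((transpose W ** S ** W) *v axis j 1)"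
      by (simp add: inner_axis' matrix_vector_mult_basis column_def)
    also have "\<dots> = (W *v axis i 1) \<bullet> (S *v (W *v axis j 1))"
      by (metis matrix_vector_mul_assoc dot_lmul_matrix inner_commute vector_transpose_matrix transpose_transpose)
    finally show ?thesis
      by (simp add: W_axis w mat_def)
  qed
  then have "transpose W ** S ** W = mat 1"
    by (simp add: vec_eq_iff)
  then show thesis by (rule that)
qed

lemma nn_integral_std_normal_density_cart:
  "(\<integral>\<^sup>+x. ennreal (\<Prod>i\<in>UNIV. std_normal_density ((x::real^'n) $ i)) \<partial>lborel) = 1"
proof -
  have "(\<integral>\<^sup>+x. ennreal (\<Prod>i\<in>UNIV. std_normal_density ((x::real^'n) $ i)) \<partial>lborel) =
      (\<integral>\<^sup>+x. (\<Prod>b\<in>Basis. ennreal (std_normal_density ((x::real^'n) \<bullet> b))) \<partial>lborel)"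
    by (simp add: prod_Basis_cart inner_axis prod_ennreal)
  also have "\<dots> = (\<Prod>b\<in>(Basis :: (real^'n) set). (\<integral>\<^sup>+t. ennreal (std_normal_density t) \<partial>lborel))"
    by (rule nn_integral_lborel_prod) auto
  also have "(\<integral>\<^sup>+t. ennreal (std_normal_density t) \<partial>lborel) = 1"
    by (simp add: nn_integral_eq_integral integrable_normal_density)
  finally show ?thesis by simp
qed

lemma prod_std_normal_density:
  "(\<Prod>i\<in>UNIV. std_normal_density ((x::real^'n) $ i)) = exp (- (x \<bullet> x) / 2) / sqrt ((2 * pi) ^ CARD('n))"
proof -
  have density: "std_normal_density t = exp (- (t * t) / 2) / sqrt (2 * pi)" for t
    by (simp add: std_normal_density_def power2_eq_square)
  have "(\<Prod>i\<in>UNIV. std_normal_density (x $ i)) =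
      exp (\<Sum>i\<in>UNIV. - (x $ i * x $ i) / 2) / sqrt (2 * pi) ^ CARD('n)"
    unfolding density by (simp only: prod_dividef prod_constant exp_sum finite)
  also have "(\<Sum>i\<in>UNIV. - (x $ i * x $ i) / 2) = - (x \<bullet> x) / 2"
    by (simp add: inner_vec_def sum_negf sum_divide_distrib)
  finally show ?thesis
    by (simp only: real_sqrt_power)
qed

lemma borel_measurable_gaussian_density [measurable]:
  "gaussian_density m S \<in> borel_measurable borel"
  unfolding gaussian_density_def by measurable

text \<open>The substitution of \<open>transpose W *v (x - m)\<close> turns the density into a
  product of standard normal densities. Its Jacobian \<bar>det W\<bar> is exactly 1 / sqrt (det S),
  because (det W)^2 * det S = 1.\<close>

lemma prob_space_gaussian:
  fixes S :: "real^'n^'n"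
  assumes S: "sym_pos_def S"
  shows "prob_space (gaussian m S)"
proof
  obtain W :: "real^'n^'n" where W: "transpose W ** S ** W = mat 1"
    using sym_pos_def_orthonormalization[OF S] by blast
  have "W ** (transpose W ** S) = mat 1"
    using W matrix_left_right_inverse[of "transpose W ** S" W] by blast
  then have QS: "(W ** transpose W) ** S = mat 1"
    by (simp add: matrix_mul_assoc)
  then have "S ** (W ** transpose W) = mat 1"
    by (simp only: matrix_left_right_inverse)
  \<comment> \<open>\<open>matrix_inv\<close> is given by a choice operator, so its defining
    property has to be drawn from the explicit two-sided inverse just found.\<close>
  then have "S ** matrix_inv S = mat 1"
    unfolding matrix_inv_def using QS by (metis (mono_tags, lifting) someI_ex)
  then have "(W ** transpose W) ** (S ** matrix_inv S) = W ** transpose W"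
    by simp
  then have inv: "matrix_inv S = W ** transpose W"
    by (simp only: matrix_mul_assoc QS matrix_mul_lid)
  have quad: "x \<bullet> (matrix_inv S *v x) = (transpose W *v x) \<bullet> (transpose W *v x)" for x
    unfolding inv by (metis matrix_vector_mul_assoc dot_lmul_matrix vector_transpose_matrix transpose_transpose)
  have "det (transpose W ** S ** W) = 1"
    by (simp add: W)
  then have det: "(det W)\<^sup>2 * det S = 1"
    by (simp add: det_mul power2_eq_square mult_ac)
  then have nz: "det (transpose W) \<noteq> 0"
    by auto
  have "det S = (inverse \<bar>det W\<bar>)\<^sup>2"
    using det nz by (simp add: field_simps power2_eq_square)
  then have sqrt_det: "sqrt (det S) = inverse \<bar>det W\<bar>"
    by simp
  define g where "g x = ennreal (\<Prod>i\<in>UNIV. std_normal_density ((x::real^'n) $ i))" for x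
  have [measurable]: "g \<in> borel_measurable borel"
    unfolding g_def prod_std_normal_density
    by (intro measurable_compose[OF _ measurable_ennreal] borel_measurable_continuous_onI continuous_intros) auto
  have dens: "ennreal (gaussian_density m S x) = ennreal \<bar>det (transpose W)\<bar> * g (transpose W *v (x - m))" for x
    unfolding g_def gaussian_density_def prod_std_normal_density quad
    by (simp add: real_sqrt_mult sqrt_det ennreal_mult[symmetric] field_simps)
  have shift: "(\<lambda>x. g (transpose W *v (x - m))) \<in> borel_measurable borel"
    by measurable
  have "emeasure (gaussian m S) (space (gaussian m S)) = (\<integral>\<^sup>+x. ennreal (gaussian_density m S x) \<partial>lborel)"
    unfolding gaussian_def by (simp add: emeasure_density)
  also have "\<dots> = ennreal \<bar>det (transpose W)\<bar> * (\<integral>\<^sup>+x. g (transpose W *v (x - m)) \<partial>lborel)"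
    unfolding dens by (rule nn_integral_cmult) measurable
  also have "(\<integral>\<^sup>+x. g (transpose W *v (x - m)) \<partial>lborel) = (\<integral>\<^sup>+x. g (transpose W *v x) \<partial>lborel)"
    using nn_integral_distr[of "(+) m" lborel borel "\<lambda>x. g (transpose W *v (x - m))"] shift
    by (simp add: lborel_distr_plus)
  also have "ennreal \<bar>det (transpose W)\<bar> * \<dots> = (\<integral>\<^sup>+x. g x \<partial>lborel)"
    using nz by (intro nn_integral_lborel_matrix) auto
  also have "\<dots> = 1"
    unfolding g_def by (rule nn_integral_std_normal_density_cart)
  finally show "emeasure (gaussian m S) (space (gaussian m S)) = 1" .
qed

text \<open>The reflection x \<mapsto> 2 m - x preserves the Gaussian law and exchanges the two
  closed half-spaces bounded by the hyperplane through m. They have equal mass and cover the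
  space.\<close>

lemma gaussian_halfspace_ge_half:
  fixes S :: "real^'n^'n"
  assumes S: "sym_pos_def S"
  shows "1 / 2 \<le> measure (gaussian m S) {x. 0 \<le> \<theta> \<bullet> (x - m)}"
proof -
  interpret prob_space "gaussian m S"
    by (rule prob_space_gaussian[OF S])
  have sets: "sets (gaussian m S) = sets borel"
    by (simp add: gaussian_def)
  have H: "{x. 0 \<le> \<theta> \<bullet> (x - m)} \<in> sets borel" "{x. \<theta> \<bullet> (x - m) \<le> 0} \<in> sets borel"
    by measurable
  have refl: "distr lborel borel (\<lambda>x. 2 *\<^sub>R m + (-1) *\<^sub>R x) = lborel"
    using lborel_affine[of "-1" "2 *\<^sub>R m"] by (simp add: density_1)
  have neg: "2 *\<^sub>R m + (-1) *\<^sub>R x - m = - (x - m)" for x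
    by (simp add: scaleR_2)
  have dens: "gaussian_density m S (2 *\<^sub>R m + (-1) *\<^sub>R x) = gaussian_density m S x" for x
  proof -
    have "A *v (- y) = - (A *v y)" for A :: "real^'n^'n" and y
      using matrix_vector_mult_diff_distrib[of A 0 y] by simp
    then show ?thesis
      by (simp only: gaussian_density_def neg inner_minus_left inner_minus_right minus_minus)
  qed
  have "emeasure (gaussian m S) {x. 0 \<le> \<theta> \<bullet> (x - m)} =
      (\<integral>\<^sup>+x. ennreal (gaussian_density m S x) * indicator {x. 0 \<le> \<theta> \<bullet> (x - m)} x \<partial>lborel)"
    using H by (simp add: gaussian_def emeasure_density)
  also have "\<dots> = (\<integral>\<^sup>+x. ennreal (gaussian_density m S (2 *\<^sub>R m + (-1) *\<^sub>R x)) *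
      indicator {x. 0 \<le> \<theta> \<bullet> (x - m)} (2 *\<^sub>R m + (-1) *\<^sub>R x) \<partial>lborel)"
    using H by (subst refl[symmetric]) (subst nn_integral_distr, auto)
  also have "\<dots> = (\<integral>\<^sup>+x. ennreal (gaussian_density m S x) * indicator {x. \<theta> \<bullet> (x - m) \<le> 0} x \<partial>lborel)"
    unfolding dens
    by (intro nn_integral_cong) (simp only: indicator_def mem_Collect_eq neg inner_minus_right neg_0_le_iff_le)
  also have "\<dots> = emeasure (gaussian m S) {x. \<theta> \<bullet> (x - m) \<le> 0}"
    using H by (simp add: gaussian_def emeasure_density)
  finally have "prob {x. 0 \<le> \<theta> \<bullet> (x - m)} = prob {x. \<theta> \<bullet> (x - m) \<le> 0}"
    by (simp add: measure_def)
  moreover have "1 \<le> prob {x. 0 \<le> \<theta> \<bullet> (x - m)} + prob {x. \<theta> \<bullet> (x - m) \<le> 0}"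
  proof -
    have "{x. 0 \<le> \<theta> \<bullet> (x - m)} \<union> {x. \<theta> \<bullet> (x - m) \<le> 0} = space (gaussian m S)"
      by (auto simp: gaussian_def)
    then show ?thesis
      using measure_Un_le[of "{x. 0 \<le> \<theta> \<bullet> (x - m)}" "gaussian m S" "{x. \<theta> \<bullet> (x - m) \<le> 0}"] H
      by (simp add: sets prob_space)
  qed
  ultimately show ?thesis by simp
qed

text \<open>The half-space through m is contained in the one through the origin when m lies on its
  closed positive side.\<close>

lemma p_hat_P_ge_half:
  assumes "sym_pos_def S" and "0 \<le> \<theta> \<bullet> m"
  shows "1 / 2 \<le> p_hat_P m S \<theta>"
proof -
  interpret prob_space "gaussian m S"
    by (rule prob_space_gaussian[OF assms(1)])
  have "{x. 0 \<le> \<theta> \<bullet> x} \<in> sets (gaussian m S)"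
    by (simp add: gaussian_def) measurable
  moreover have "{x. 0 \<le> \<theta> \<bullet> (x - m)} \<subseteq> {x. 0 \<le> \<theta> \<bullet> x}"
    using assms(2) by (auto simp: inner_diff_right)
  ultimately show ?thesis
    unfolding p_hat_P_def using gaussian_halfspace_ge_half[OF assms(1), of m \<theta>] finite_measure_mono
    by (meson order_trans)
qed

text \<open>The inclusion of half-spaces for -\<theta>. Strict negativity at m places the closed
  half-space through m inside the open set \<theta> \<bullet> x < 0 that defines
  \<open>p_hat_N\<close>.\<close>

lemma p_hat_N_ge_half:
  assumes "sym_pos_def S" and "\<theta> \<bullet> m < 0"
  shows "1 / 2 \<le> p_hat_N m S \<theta>"
proof -
  interpret prob_space "gaussian m S"
    by (rule prob_space_gaussian[OF assms(1)])
  have "{x. \<theta> \<bullet> x < 0} \<in> sets (gaussian m S)"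
    by (simp add: gaussian_def) measurable
  moreover have "{x. 0 \<le> (- \<theta>) \<bullet> (x - m)} \<subseteq> {x. \<theta> \<bullet> x < 0}"
    using assms(2) by (auto simp: inner_diff_right)
  ultimately show ?thesis
    unfolding p_hat_N_def using gaussian_halfspace_ge_half[OF assms(1), of m "- \<theta>"] finite_measure_mono
    by (meson order_trans)
qed

subsection \<open>The dynamics near the origin\<close>

lemma outer_mult: "outer u v *v x = (v \<bullet> x) *\<^sub>R u"
  by (simp add: vec_eq_iff outer_def matrix_vector_mult_def inner_vec_def sum_distrib_left sum_distrib_right mult_ac)

text \<open>
  For small weights \<open>\<theta>\<close> is close to \<open>(x u - y v) / r\<close>; strictness in Cauchy--Schwarz then decides
  the sign of \<open>\<theta> \<bullet> u\<close> whenever \<open>x \<parallel>u\<parallel>\<close> dominates \<open>y \<parallel>v\<parallel>\<close>.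
\<close>

lemma small_weights_inner_pos:
  fixes u v :: "real^'n" and M N :: "real^'n^'n"
  assumes "0 < r" and indep: "\<not> (\<exists>c::real. u = c *\<^sub>R v \<or> v = c *\<^sub>R u)"
    and M: "\<And>z. 0 \<le> z \<bullet> (M *v z)" and N: "\<And>z. 0 \<le> z \<bullet> (N *v z)"
  shows "\<exists>e>0. \<forall>x y \<theta>. 0 < x \<longrightarrow> x < e \<longrightarrow> 0 \<le> y \<longrightarrow> y < e \<longrightarrow> norm v * y \<le> norm u * x \<longrightarrow>
    r *\<^sub>R \<theta> + x *\<^sub>R (M *v \<theta>) + y *\<^sub>R (N *v \<theta>) = x *\<^sub>R u - y *\<^sub>R v \<longrightarrow> 0 < \<theta> \<bullet> u"
proof -
  have "u \<noteq> 0" "v \<noteq> 0"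
    using indep by (metis scaleR_zero_left)+
  then have nu: "norm u > 0" and nv: "norm v > 0" by auto
  define c where "c = \<bar>u \<bullet> v\<bar>"
  \<comment> \<open>Equality in Cauchy-Schwarz would make u and v proportional.\<close>
  have "c \<noteq> norm u * norm v"
  proof
    assume "c = norm u * norm v"
    then have "norm u *\<^sub>R v = norm v *\<^sub>R u \<or> norm u *\<^sub>R v = - norm v *\<^sub>R u"
      unfolding c_def norm_cauchy_schwarz_abs_eq by simp
    moreover have "v = (s / norm u) *\<^sub>R u" if "norm u *\<^sub>R v = s *\<^sub>R u" for s
    proof -
      have "v = (1 / norm u) *\<^sub>R (norm u *\<^sub>R v)"
        using nu by simp
      then show ?thesis
        unfolding that by simp
    qed
    ultimately show False using indep by blast
  qed
  then have "c < norm u * norm v"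
    using Cauchy_Schwarz_ineq2[of u v] by (simp add: c_def)
  \<comment> \<open>The leading term: if y * norm v \<le> x * norm u, then the inner product of x u
    - y v with u is at least norm u * x * gap.\<close>
  define gap where "gap = norm u - c / norm v"
  have gap: "gap > 0"
    using \<open>c < norm u * norm v\<close> nv by (simp add: gap_def field_simps)
  obtain K1 where K1: "K1 > 0" "\<And>z. norm (M *v z) \<le> K1 * norm z"
    using linear_bounded_pos[OF matrix_vector_mul_linear[of M]] by blast
  obtain K2 where K2: "K2 > 0" "\<And>z. norm (N *v z) \<le> K2 * norm z"
    using linear_bounded_pos[OF matrix_vector_mul_linear[of N]] by blast
  define K where "K = K1 + K2"
  have K: "K > 0" "norm (M *v z) \<le> K * norm z" "norm (N *v z) \<le> K * norm z" for z
    using K1 K2 order_trans[OF K1(2)[of z], of "K * norm z"] order_trans[OF K2(2)[of z], of "K * norm z"]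
    by (auto simp: K_def distrib_right)
  \<comment> \<open>Chosen so that the bound 2 * e * K * norm u * (2 * x * norm u) for the error
    terms equals r times the leading term norm u * x * gap.\<close>
  define e where "e = r * gap / (4 * K * norm u)"
  have "e > 0"
    using \<open>0 < r\<close> gap K nu by (simp add: e_def)
  moreover have "0 < \<theta> \<bullet> u"
    if x: "0 < x" "x < e" and y: "0 \<le> y" "y < e" and yx: "norm v * y \<le> norm u * x"
      and eq: "r *\<^sub>R \<theta> + x *\<^sub>R (M *v \<theta>) + y *\<^sub>R (N *v \<theta>) = x *\<^sub>R u - y *\<^sub>R v" for x y \<theta>
  proof -
    have "norm (x *\<^sub>R u - y *\<^sub>R v) \<le> norm (x *\<^sub>R u) + norm (y *\<^sub>R v)"
      by (rule norm_triangle_ineq4)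
    then have b: "norm (x *\<^sub>R u - y *\<^sub>R v) \<le> 2 * x * norm u"
      using x y yx by (simp add: mult_ac)
    \<comment> \<open>Testing the equation against \<theta> itself and discarding the positive
      semidefinite terms shows that \<theta> has size of order x.\<close>
    have "r * (\<theta> \<bullet> \<theta>) \<le> \<theta> \<bullet> (r *\<^sub>R \<theta> + x *\<^sub>R (M *v \<theta>) + y *\<^sub>R (N *v \<theta>))"
      using M[of \<theta>] N[of \<theta>] x y by (simp add: inner_add_right)
    also have "\<dots> \<le> norm \<theta> * norm (x *\<^sub>R u - y *\<^sub>R v)"
      unfolding eq by (rule norm_cauchy_schwarz)
    also have "\<dots> \<le> norm \<theta> * (2 * x * norm u)"
      using b by (intro mult_left_mono) auto
    finally have "norm \<theta> * (r * norm \<theta>) \<le> norm \<theta> * (2 * x * norm u)"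
      by (simp add: dot_square_norm power2_eq_square mult_ac)
    then have r\<theta>: "r * norm \<theta> \<le> 2 * x * norm u"
      using x nu by (cases "\<theta> = 0") (auto simp: mult_le_cancel_left)
    have cK: "norm w * norm u \<ge> w \<bullet> u" for w :: "real^'n"
      by (rule norm_cauchy_schwarz)
    have MN: "w \<bullet> u \<le> K * norm \<theta> * norm u" if "w = M *v \<theta> \<or> w = N *v \<theta>" for w
      using that K(2,3)[of \<theta>] cK[of w] mult_right_mono[of "norm w" "K * norm \<theta>" "norm u"] by auto
    have "y * (v \<bullet> u) \<le> y * c"
      using y by (intro mult_left_mono) (auto simp: c_def inner_commute)
    also have "\<dots> = (norm v * y) * (c / norm v)"
      using nv by simp
    also have "\<dots> \<le> (norm u * x) * (c / norm v)"
      using yx nv by (intro mult_right_mono) (auto simp: c_def)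
    finally have yc: "y * (v \<bullet> u) \<le> (norm u * x) * (c / norm v)" .
    \<comment> \<open>The second factor r lets the a priori bound on r * norm \<theta> be inserted
      into the error terms.\<close>
    have "r * (r * (\<theta> \<bullet> u)) = r * ((x *\<^sub>R u - y *\<^sub>R v - x *\<^sub>R (M *v \<theta>) - y *\<^sub>R (N *v \<theta>)) \<bullet> u)"
      unfolding eq[symmetric] by simp
    also have "\<dots> = r * (x * (norm u)\<^sup>2 - y * (v \<bullet> u) - x * ((M *v \<theta>) \<bullet> u) - y * ((N *v \<theta>) \<bullet> u))"
      by (simp add: inner_diff_left dot_square_norm)
    also have "\<dots> \<ge> r * (x * (norm u)\<^sup>2 - (norm u * x) * (c / norm v) - x * (K * norm \<theta> * norm u) - y * (K * norm \<theta> * norm u))"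
      using yc MN x y \<open>0 < r\<close> by (intro mult_left_mono diff_mono) auto
    also have "r * (x * (norm u)\<^sup>2 - (norm u * x) * (c / norm v) - x * (K * norm \<theta> * norm u) - y * (K * norm \<theta> * norm u)) =
        r * (norm u * x * gap) - (x + y) * K * norm u * (r * norm \<theta>)"
      unfolding gap_def by (simp add: algebra_simps power2_eq_square)
    finally have lower: "r * (norm u * x * gap) - (x + y) * K * norm u * (r * norm \<theta>) \<le> r * (r * (\<theta> \<bullet> u))" .
    have "(x + y) * K * norm u * (r * norm \<theta>) \<le> (x + y) * K * norm u * (2 * x * norm u)"
      using r\<theta> x y K(1) by (intro mult_left_mono) auto
    also have "\<dots> < (2 * e) * K * norm u * (2 * x * norm u)"
      using x y K(1) nu by (intro mult_strict_right_mono) auto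
    also have "\<dots> = r * (norm u * x * gap)"
      using K(1) nu by (simp add: e_def)
    finally have "0 < r * (r * (\<theta> \<bullet> u))"
      using lower by linarith
    then show ?thesis
      using \<open>0 < r\<close> by (simp add: zero_less_mult_iff)
  qed
  ultimately show ?thesis by blast
qed

text \<open>The regularisation makes the matrix positive definite for all nonnegative rates, so the
  inverse is genuine and the classifier can be handled through its linear equation.\<close>

lemma A_mat_mult_F_classifier:
  fixes \<mu>\<^sub>P \<mu>\<^sub>N :: "real^'n"
  assumes "0 < p" "p < 1" "0 < reg" "sym_pos_def S\<^sub>P" "sym_pos_def S\<^sub>N" "0 \<le> fst a" "0 \<le> snd a"
  shows "A_mat p reg \<mu>\<^sub>P \<mu>\<^sub>N S\<^sub>P S\<^sub>N a *v F_classifier p reg \<mu>\<^sub>P \<mu>\<^sub>N S\<^sub>P S\<^sub>N a = b_vec p \<mu>\<^sub>P \<mu>\<^sub>N a"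
proof -
  let ?A = "A_mat p reg \<mu>\<^sub>P \<mu>\<^sub>N S\<^sub>P S\<^sub>N a"
  have "0 < z \<bullet> (?A *v z)" if "z \<noteq> 0" for z
  proof -
    have "z \<bullet> (?A *v z) = (p * fst a) * (z \<bullet> (S\<^sub>P *v z) + (\<mu>\<^sub>P \<bullet> z)\<^sup>2) +
        ((1 - p) * snd a) * (z \<bullet> (S\<^sub>N *v z) + (\<mu>\<^sub>N \<bullet> z)\<^sup>2) + reg * (z \<bullet> z)"
      by (simp add: A_mat_def matrix_vector_mult_add_rdistrib scaleR_matrix_vector_assoc[symmetric] outer_mult
          inner_add_right power2_eq_square inner_commute)
    moreover have "0 < z \<bullet> (S\<^sub>P *v z)" "0 < z \<bullet> (S\<^sub>N *v z)"
      using assms that by (auto simp: sym_pos_def_def)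
    ultimately show ?thesis
      using assms that by (auto intro!: add_nonneg_pos add_nonneg_nonneg mult_nonneg_nonneg)
  qed
  then have "invertible ?A"
    by (rule invertible_if_pos_quadratic_form)
  then have "?A ** matrix_inv ?A = mat 1"
    unfolding invertible_def matrix_inv_def by (metis (mono_tags, lifting) someI_ex)
  then show ?thesis
    by (simp add: F_classifier_def matrix_vector_mul_assoc)
qed

lemma proj_velocity_nonneg:
  assumes "a < 1" and "a \<noteq> 0 \<Longrightarrow> 0 \<le> v"
  shows "0 \<le> proj_velocity a v"
  using assms by (simp add: proj_velocity_def)

text \<open>The class with the larger norm-weighted rate pulls \<theta> to its own side, is then
  classified correctly with probability at least one half, and does not lose users. Rates below 1
  exclude the branch of the projection that cuts off positive velocities.\<close>

lemma reduced_field_nonneg_near_0: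
  fixes \<mu>\<^sub>P \<mu>\<^sub>N :: "real^'n"
  assumes p: "0 < p" "p < 1" and reg: "0 < reg"
    and indep: "\<not> (\<exists>c::real. \<mu>\<^sub>P = c *\<^sub>R \<mu>\<^sub>N \<or> \<mu>\<^sub>N = c *\<^sub>R \<mu>\<^sub>P)"
    and S: "sym_pos_def S\<^sub>P" "sym_pos_def S\<^sub>N"
  shows "\<exists>e>0. \<forall>a. 0 \<le> fst a \<longrightarrow> fst a < 1 \<longrightarrow> 0 \<le> snd a \<longrightarrow> snd a < 1 \<longrightarrow>
    p * fst a < e \<longrightarrow> (1 - p) * snd a < e \<longrightarrow>
    (norm \<mu>\<^sub>N * ((1 - p) * snd a) \<le> norm \<mu>\<^sub>P * (p * fst a) \<longrightarrow> 0 \<le> fst (reduced_field p reg \<mu>\<^sub>P \<mu>\<^sub>N S\<^sub>P S\<^sub>N a)) \<and>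
    (norm \<mu>\<^sub>P * (p * fst a) \<le> norm \<mu>\<^sub>N * ((1 - p) * snd a) \<longrightarrow> 0 \<le> snd (reduced_field p reg \<mu>\<^sub>P \<mu>\<^sub>N S\<^sub>P S\<^sub>N a))"
proof -
  let ?M = "S\<^sub>P + outer \<mu>\<^sub>P \<mu>\<^sub>P" and ?N = "S\<^sub>N + outer \<mu>\<^sub>N \<mu>\<^sub>N"
  have psd: "0 \<le> z \<bullet> ((T + outer m m) *v z)" if "sym_pos_def T" for T and z m :: "real^'n"
  proof -
    have "0 \<le> z \<bullet> (T *v z)"
      using that by (cases "z = 0") (auto simp: sym_pos_def_def less_imp_le)
    then show ?thesis
      by (simp add: matrix_vector_mult_add_rdistrib outer_mult inner_add_right inner_commute)
  qed
  obtain e1 where "e1 > 0" and e1: "\<forall>x y \<theta>. 0 < x \<longrightarrow> x < e1 \<longrightarrow> 0 \<le> y \<longrightarrow> y < e1 \<longrightarrow> norm \<mu>\<^sub>N * y \<le> norm \<mu>\<^sub>P * x \<longrightarrow>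
      reg *\<^sub>R \<theta> + x *\<^sub>R (?M *v \<theta>) + y *\<^sub>R (?N *v \<theta>) = x *\<^sub>R \<mu>\<^sub>P - y *\<^sub>R \<mu>\<^sub>N \<longrightarrow> 0 < \<theta> \<bullet> \<mu>\<^sub>P"
    using small_weights_inner_pos[OF reg indep psd[OF S(1)] psd[OF S(2)]] by blast
  have indep': "\<not> (\<exists>c::real. \<mu>\<^sub>N = c *\<^sub>R \<mu>\<^sub>P \<or> \<mu>\<^sub>P = c *\<^sub>R \<mu>\<^sub>N)"
    using indep by blast
  obtain e2 where "e2 > 0" and e2: "\<forall>x y \<theta>. 0 < x \<longrightarrow> x < e2 \<longrightarrow> 0 \<le> y \<longrightarrow> y < e2 \<longrightarrow> norm \<mu>\<^sub>P * y \<le> norm \<mu>\<^sub>N * x \<longrightarrow>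
      reg *\<^sub>R \<theta> + x *\<^sub>R (?N *v \<theta>) + y *\<^sub>R (?M *v \<theta>) = x *\<^sub>R \<mu>\<^sub>N - y *\<^sub>R \<mu>\<^sub>P \<longrightarrow> 0 < \<theta> \<bullet> \<mu>\<^sub>N"
    using small_weights_inner_pos[OF reg indep' psd[OF S(2)] psd[OF S(1)]] by blast
  have "(norm \<mu>\<^sub>N * ((1 - p) * snd a) \<le> norm \<mu>\<^sub>P * (p * fst a) \<longrightarrow> 0 \<le> fst (reduced_field p reg \<mu>\<^sub>P \<mu>\<^sub>N S\<^sub>P S\<^sub>N a)) \<and>
    (norm \<mu>\<^sub>P * (p * fst a) \<le> norm \<mu>\<^sub>N * ((1 - p) * snd a) \<longrightarrow> 0 \<le> snd (reduced_field p reg \<mu>\<^sub>P \<mu>\<^sub>N S\<^sub>P S\<^sub>N a))"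
    if a: "0 \<le> fst a" "fst a < 1" "0 \<le> snd a" "snd a < 1"
      and small: "p * fst a < min e1 e2" "(1 - p) * snd a < min e1 e2" for a
  proof -
    let ?x = "p * fst a" and ?y = "(1 - p) * snd a"
    define \<theta> where "\<theta> = F_classifier p reg \<mu>\<^sub>P \<mu>\<^sub>N S\<^sub>P S\<^sub>N a"
    have field: "reduced_field p reg \<mu>\<^sub>P \<mu>\<^sub>N S\<^sub>P S\<^sub>N a =
        (proj_velocity (fst a) (?x * (2 * p_hat_P \<mu>\<^sub>P S\<^sub>P \<theta> - 1)),
         proj_velocity (snd a) (?y * (2 * p_hat_N \<mu>\<^sub>N S\<^sub>N \<theta> - 1)))"
      by (simp add: reduced_field_def \<theta>_def Let_def)
    have eq: "reg *\<^sub>R \<theta> + ?x *\<^sub>R (?M *v \<theta>) + ?y *\<^sub>R (?N *v \<theta>) = ?x *\<^sub>R \<mu>\<^sub>P - ?y *\<^sub>R \<mu>\<^sub>N"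
      using A_mat_mult_F_classifier[OF p reg S a(1,3), of \<mu>\<^sub>P \<mu>\<^sub>N]
      by (simp add: \<theta>_def[symmetric] A_mat_def b_vec_def matrix_vector_mult_add_rdistrib
          scaleR_matrix_vector_assoc[symmetric] scaleR_add_right add_ac)
    have neg: "B *v (- z) = - (B *v z)" for B :: "real^'n^'n" and z
      using matrix_vector_mult_diff_distrib[of B 0 z] by simp
    \<comment> \<open>Exchanging the classes replaces \<theta> by -\<theta>, so the niche case is
      the same small-weight statement with the roles swapped; it yields the strict sign that
      \<open>p_hat_N_ge_half\<close> requires.\<close>
    have eq': "reg *\<^sub>R (- \<theta>) + ?y *\<^sub>R (?N *v (- \<theta>)) + ?x *\<^sub>R (?M *v (- \<theta>)) = ?y *\<^sub>R \<mu>\<^sub>N - ?x *\<^sub>R \<mu>\<^sub>P"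
    proof -
      have "reg *\<^sub>R (- \<theta>) + ?y *\<^sub>R (?N *v (- \<theta>)) + ?x *\<^sub>R (?M *v (- \<theta>)) =
          - (reg *\<^sub>R \<theta> + ?x *\<^sub>R (?M *v \<theta>) + ?y *\<^sub>R (?N *v \<theta>))"
        unfolding neg by simp
      then show ?thesis
        unfolding eq by simp
    qed
    have xy: "0 \<le> ?x" "0 \<le> ?y"
      using p a by auto
    show ?thesis
    proof (intro conjI impI)
      assume dom: "norm \<mu>\<^sub>N * ?y \<le> norm \<mu>\<^sub>P * ?x"
      \<comment> \<open>At \<open>fst a = 0\<close> the projection is nonnegative by itself, so the
        sign of \<theta> matters only for positive weight.\<close>
      have "1 / 2 \<le> p_hat_P \<mu>\<^sub>P S\<^sub>P \<theta>" if "fst a \<noteq> 0"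
      proof -
        have "0 < ?x" using that p a by simp
        then have "0 < \<theta> \<bullet> \<mu>\<^sub>P"
          using e1 small xy dom eq by auto
        then show ?thesis
          using p_hat_P_ge_half[OF S(1)] by simp
      qed
      then show "0 \<le> fst (reduced_field p reg \<mu>\<^sub>P \<mu>\<^sub>N S\<^sub>P S\<^sub>N a)"
        unfolding field fst_conv using a(2)
        by (intro proj_velocity_nonneg mult_nonneg_nonneg[OF xy(1)]) auto
    next
      assume dom: "norm \<mu>\<^sub>P * ?x \<le> norm \<mu>\<^sub>N * ?y"
      have "1 / 2 \<le> p_hat_N \<mu>\<^sub>N S\<^sub>N \<theta>" if "snd a \<noteq> 0"
      proof -
        have "0 < ?y" using that p a by simp
        then have "0 < (- \<theta>) \<bullet> \<mu>\<^sub>N"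
          using e2[rule_format, of ?y ?x "- \<theta>"] small xy dom eq' by auto
        then show ?thesis
          using p_hat_N_ge_half[OF S(2)] by simp
      qed
      then show "0 \<le> snd (reduced_field p reg \<mu>\<^sub>P \<mu>\<^sub>N S\<^sub>P S\<^sub>N a)"
        unfolding field snd_conv using a(4)
        by (intro proj_velocity_nonneg mult_nonneg_nonneg[OF xy(2)]) auto
    qed
  qed
  then show ?thesis
    using \<open>e1 > 0\<close> \<open>e2 > 0\<close> by (intro exI[of _ "min e1 e2"]) simp
qed

section \<open>Monotonicity of the truncated maximum along a solution\<close>

theorem theorem4p1:
  fixes p reg :: real
    and \<mu>\<^sub>P \<mu>\<^sub>N :: "real^'n"
    and S\<^sub>P S\<^sub>N :: "real^'n^'n"
    and \<alpha> :: "real \<Rightarrow> real \<times> real"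
  assumes "0 < p" and "p < 1"
    and "reg > 0"
    and "\<not> (\<exists>c::real. \<mu>\<^sub>P = c *\<^sub>R \<mu>\<^sub>N \<or> \<mu>\<^sub>N = c *\<^sub>R \<mu>\<^sub>P)"
    and "sym_pos_def S\<^sub>P" and "sym_pos_def S\<^sub>N"
    and "reduced_solution p reg \<mu>\<^sub>P \<mu>\<^sub>N S\<^sub>P S\<^sub>N \<alpha>"
    and "\<alpha> 0 \<in> {0..1} \<times> {0..1} - {(0, 0)}"
  shows "\<not> (\<alpha> \<longlongrightarrow> (0, 0)) at_top"
proof
  assume lim: "(\<alpha> \<longlongrightarrow> (0, 0)) at_top"
  let ?field = "reduced_field p reg \<mu>\<^sub>P \<mu>\<^sub>N S\<^sub>P S\<^sub>N"
  obtain e where "e > 0" and e: "\<forall>a. 0 \<le> fst a \<longrightarrow> fst a < 1 \<longrightarrow> 0 \<le> snd a \<longrightarrow> snd a < 1 \<longrightarrow>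
    p * fst a < e \<longrightarrow> (1 - p) * snd a < e \<longrightarrow>
    (norm \<mu>\<^sub>N * ((1 - p) * snd a) \<le> norm \<mu>\<^sub>P * (p * fst a) \<longrightarrow> 0 \<le> fst (?field a)) \<and>
    (norm \<mu>\<^sub>P * (p * fst a) \<le> norm \<mu>\<^sub>N * ((1 - p) * snd a) \<longrightarrow> 0 \<le> snd (?field a))"
    using reduced_field_nonneg_near_0[OF assms(1-6)] by blast
  have range: "\<alpha> t \<in> {0..1} \<times> {0..1}" if "t \<ge> 0" for t
    using assms(7) that unfolding reduced_solution_def by blast
  have ac: "abs_continuous_on {0..T} \<alpha>" if "T \<ge> 0" for T
    using assms(7) that unfolding reduced_solution_def by blast
  have ae: "AE t in lebesgue. t \<ge> 0 \<longrightarrow> (\<alpha> has_vector_derivative ?field (\<alpha> t)) (at t within {0..})"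
    using assms(7) unfolding reduced_solution_def by blast
  have nP: "norm \<mu>\<^sub>P > 0" and nN: "norm \<mu>\<^sub>N > 0"
    using assms(4) by (metis scaleR_zero_left zero_less_norm_iff)+
  define kP where "kP = norm \<mu>\<^sub>P * p"
  define kN where "kN = norm \<mu>\<^sub>N * (1 - p)"
  have k: "kP > 0" "kN > 0"
    using nP nN assms(1,2) by (auto simp: kP_def kN_def)
  \<comment> \<open>Whenever the maximum of f and g is at most c, both weights are below e and both
    rates are below 1, so the sign information near the origin applies. Halving makes the
    inequalities strict.\<close>
  define c where "c = min (norm \<mu>\<^sub>P * min e p) (norm \<mu>\<^sub>N * min e (1 - p)) / 2"
  have c: "0 < c" "c < norm \<mu>\<^sub>P * min e p" "c < norm \<mu>\<^sub>N * min e (1 - p)"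
  proof -
    have "0 < norm \<mu>\<^sub>P * min e p" "0 < norm \<mu>\<^sub>N * min e (1 - p)"
      using nP nN \<open>e > 0\<close> assms(1,2) by (auto intro!: mult_pos_pos)
    then show "0 < c" "c < norm \<mu>\<^sub>P * min e p" "c < norm \<mu>\<^sub>N * min e (1 - p)"
      by (auto simp: c_def min_def split: if_splits)
  qed
  define f where "f t = kP * fst (\<alpha> t)" for t
  define g where "g t = kN * snd (\<alpha> t)" for t
  define V where "V t = min (max (f t) (g t)) c" for t
  have slope: "nonneg_slope_at V {0..T} t"
    if "t \<in> {0..T}" and deriv: "(\<alpha> has_vector_derivative ?field (\<alpha> t)) (at t within {0..})" for T t
  proof -
    have deriv': "(\<alpha> has_vector_derivative ?field (\<alpha> t)) (at t within {0..T})"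
      using deriv by (rule has_vector_derivative_within_subset) auto
    have "(f has_real_derivative kP * fst (?field (\<alpha> t))) (at t within {0..T})"
      unfolding f_def using bounded_linear.has_vector_derivative[OF bounded_linear_fst deriv']
      by (intro DERIV_cmult) (simp add: has_real_derivative_iff_has_vector_derivative)
    moreover have "(g has_real_derivative kN * snd (?field (\<alpha> t))) (at t within {0..T})"
      unfolding g_def using bounded_linear.has_vector_derivative[OF bounded_linear_snd deriv']
      by (intro DERIV_cmult) (simp add: has_real_derivative_iff_has_vector_derivative)
    moreover have "(g t \<le> f t \<longrightarrow> 0 \<le> kP * fst (?field (\<alpha> t))) \<and> (f t \<le> g t \<longrightarrow> 0 \<le> kN * snd (?field (\<alpha> t)))"
      if le: "max (f t) (g t) \<le> c"
    proof -
      have "norm \<mu>\<^sub>P * (p * fst (\<alpha> t)) < norm \<mu>\<^sub>P * min e p"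
        "norm \<mu>\<^sub>N * ((1 - p) * snd (\<alpha> t)) < norm \<mu>\<^sub>N * min e (1 - p)"
        using le c by (auto simp: f_def g_def kP_def kN_def mult.assoc)
      then have "p * fst (\<alpha> t) < e" "p * fst (\<alpha> t) < p * 1"
        "(1 - p) * snd (\<alpha> t) < e" "(1 - p) * snd (\<alpha> t) < (1 - p) * 1"
        using nP nN by (auto simp: mult_less_cancel_left_pos)
      then have "p * fst (\<alpha> t) < e" "fst (\<alpha> t) < 1" "(1 - p) * snd (\<alpha> t) < e" "snd (\<alpha> t) < 1"
        using assms(1,2) by (simp_all add: mult_less_cancel_left_pos del: mult_1_right)
      moreover have "0 \<le> fst (\<alpha> t)" "0 \<le> snd (\<alpha> t)"
        using range[of t] \<open>t \<in> {0..T}\<close> by (auto simp: mem_Times_iff)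
      ultimately have "(g t \<le> f t \<longrightarrow> 0 \<le> fst (?field (\<alpha> t))) \<and> (f t \<le> g t \<longrightarrow> 0 \<le> snd (?field (\<alpha> t)))"
        using e unfolding f_def g_def kP_def kN_def mult.assoc by blast
      then show ?thesis
        using k by simp
    qed
    ultimately show ?thesis
      unfolding V_def by (intro nonneg_slope_at_min_max) auto
  qed
  have mono: "V 0 \<le> V T" if "T \<ge> 0" for T
  proof (rule abs_continuous_on_nonneg_slope_imp_le[OF that])
    show "abs_continuous_on {0..T} V"
    proof (rule abs_continuous_on_lipschitz[OF ac[OF that]])
      fix u v
      have "\<bar>f v - f u\<bar> \<le> kP * norm (\<alpha> v - \<alpha> u)" "\<bar>g v - g u\<bar> \<le> kN * norm (\<alpha> v - \<alpha> u)"
        using k norm_fst_le[of "fst (\<alpha> v - \<alpha> u)" "snd (\<alpha> v - \<alpha> u)"]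
          norm_snd_le[of "snd (\<alpha> v - \<alpha> u)" "fst (\<alpha> v - \<alpha> u)"]
        by (auto simp: f_def g_def abs_mult simp flip: right_diff_distrib fst_diff snd_diff simp del: fst_diff snd_diff)
      moreover have "0 \<le> kP * norm (\<alpha> v - \<alpha> u)" "0 \<le> kN * norm (\<alpha> v - \<alpha> u)"
        using k by auto
      \<comment> \<open>Maximum and truncation are nonexpansive, so any common bound for the
        Lipschitz constants kP and kN works; their sum is one.\<close>
      ultimately show "norm (V v - V u) \<le> (kP + kN) * norm (\<alpha> v - \<alpha> u)"
        unfolding V_def real_norm_def distrib_right by linarith
    qed
    show "AE t in lebesgue. t \<in> {0..T} \<longrightarrow> nonneg_slope_at V {0..T} t"
      using ae by eventually_elim (use slope in auto)
  qed
  have "0 < V 0"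
  proof -
    have "0 < fst (\<alpha> 0) \<or> 0 < snd (\<alpha> 0)" "0 \<le> fst (\<alpha> 0)" "0 \<le> snd (\<alpha> 0)"
      using assms(8) by (auto simp: prod_eq_iff)
    then show ?thesis
      using k c(1) by (auto simp: V_def f_def g_def less_max_iff_disj)
  qed
  \<comment> \<open>The limit is left unevaluated so that the continuity rules for
    \<open>fst\<close>, \<open>snd\<close>, \<open>max\<close> and \<open>min\<close> match it; it
    equals 0 because c > 0.\<close>
  have "(V \<longlongrightarrow> min (max (kP * fst (0::real, 0::real)) (kN * snd (0::real, 0::real))) c) at_top"
    unfolding V_def f_def g_def by (intro tendsto_intros lim)
  then have "(V \<longlongrightarrow> 0) at_top"
    using c(1) by simp
  then have "\<forall>\<^sub>F t in at_top. V t < V 0"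
    using \<open>0 < V 0\<close> by (rule order_tendstoD)
  then obtain T where "T \<ge> 0" "V T < V 0"
    by (metis eventually_at_top_linorder linorder_le_cases order_refl)
  then show False
    using mono by fastforce
qed

end
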